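(* Every cylinder $A\subseteq\Sigma^\ast$ whose complement is recursively enumerable, other than $A=\emptyset$, is $\mathrm{F_{REC}}$-compressible.
   Context: $\Sigma=\{0,1\}$. Fix a standard recursive bijection $\langle\cdot,\cdot\rangle:\Sigma^\ast\times\Sigma^\ast\to\Sigma^\ast$. A set $A$ is a cylinder if there exist a set $B\subseteq\Sigma^\ast$ and a total recursive bijection $h:\Sigma^\ast\to\Sigma^\ast$ with $h(A)=\{\langle b,y\rangle\mid b\in B,\ y\in\Sigma^\ast\}$ (i.e., $A$ is recursively isomorphic to $B\times\Sigma^\ast$). $\mathrm{F_{REC}}$ is the class of total recursive functions $\Sigma^\ast\to\Sigma^\ast$. A function $f$ is a compression function for $A$ if $f$ is defined on all of $A$, $f(A)=\Sigma^\ast$, and $f$ is injective on $A$ (no condition outside $A$); $A$ is $\mathrm{F_{REC}}$-compressible if it has a compression function in $\mathrm{F_{REC}}$. *)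

theory Defs
  imports Main "HOL-Library.Nat_Bijection"
begin

type_synonym word = "bool list"

datatype recf =
    Zero
  | Succ
  | Proj nat
  | Comp recf "recf list"
  | Prim recf recf
  | Mu recf

text \<open>
  \<open>computes c xs y\<close>: the partial recursive function with description \<open>c\<close> is defined at the
  argument tuple \<open>xs\<close>, with value \<open>y\<close>. The recursion argument of \<open>Prim\<close> and the search
  argument of \<open>Mu\<close> come first; the step function of \<open>Prim\<close> receives the counter, the previous
  value and the parameters, in this order. As usual, \<open>Mu\<close> requires all values
  below the least zero to be defined.
\<close>

inductive computes :: "recf \<Rightarrow> nat list \<Rightarrow> nat \<Rightarrow> bool" where
  zero: "computes Zero xs 0"
| succ: "computes Succ [x] (Suc x)"
| proj: "i < length xs \<Longrightarrow> computes (Proj i) xs (xs ! i)"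
| comp: "list_all2 (\<lambda>g y. computes g xs y) gs ys \<Longrightarrow> computes f ys z \<Longrightarrow> computes (Comp f gs) xs z"
| prim_0: "computes f xs y \<Longrightarrow> computes (Prim f g) (0 # xs) y"
| prim_Suc: "computes (Prim f g) (n # xs) y \<Longrightarrow> computes g (n # y # xs) z
    \<Longrightarrow> computes (Prim f g) (Suc n # xs) z"
| mu: "computes f (n # xs) 0 \<Longrightarrow> \<forall>m<n. \<exists>y. computes f (m # xs) (Suc y)
    \<Longrightarrow> computes (Mu f) xs n"

lemma computes_deterministic: "computes c xs y \<Longrightarrow> computes c xs z \<Longrightarrow> y = z"
proof (induction arbitrary: z rule: computes.induct)
  case (zero xs)
  then show ?case by (cases rule: computes.cases) auto
next
  case (succ x)
  then show ?case by (cases rule: computes.cases) auto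
next
  case (proj i xs)
  from proj(2) show ?case by (cases rule: computes.cases) auto
next
  case (comp xs gs ys f z')
  from comp.prems obtain zs where zs: "list_all2 (\<lambda>g y. computes g xs y) gs zs" "computes f zs z"
    by (cases rule: computes.cases) auto
  have "ys = zs"
    using comp.IH(1) zs(1) by (auto simp: list_all2_conv_all_nth intro!: nth_equalityI)
  then show ?case using comp.IH(2) zs(2) by blast
next
  case (prim_0 f xs y g)
  from prim_0.prems show ?case by (cases rule: computes.cases) (auto intro: prim_0.IH)
next
  case (prim_Suc f g n xs y z')
  from prim_Suc.prems obtain y' where "computes (Prim f g) (n # xs) y'" "computes g (n # y' # xs) z"
    by (cases rule: computes.cases) auto
  then show ?case using prim_Suc.IH by blast
next
  case (mu f n xs)
  from mu.prems have z: "computes f (z # xs) 0" "\<forall>m<z. \<exists>y. computes f (m # xs) (Suc y)"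
    by (cases rule: computes.cases; auto)+
  show ?case
  proof (rule linorder_cases[of n z])
    assume "n < z"
    then obtain y where "computes f (n # xs) (Suc y)" using z(2) by blast
    then show ?thesis using mu.IH(1) by blast
  next
    assume "z < n"
    then obtain y where "\<And>u. computes f (z # xs) u \<Longrightarrow> Suc y = u" using mu.IH(2) by blast
    then show ?thesis using z(1) by blast
  qed
qed

text \<open>
  The rank of a word in the length-lexicographic order, that is, bijective base-2 notation with
  \<open>False\<close> as digit 1 and \<open>True\<close> as digit 2, most significant digit first. Recursiveness on
  words is transported from the natural numbers along this bijection.
\<close>

definition word_code :: "word \<Rightarrow> nat" where
  "word_code w = foldl (\<lambda>n b. 2 * n + (if b then 2 else 1)) 0 w"

definition word_decode :: "nat \<Rightarrow> word" where
  "word_decode = inv word_code"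

lemma word_code_Nil [simp]: "word_code [] = 0"
  by (simp add: word_code_def)

lemma word_code_snoc [simp]: "word_code (w @ [b]) = 2 * word_code w + (if b then 2 else 1)"
  by (simp add: word_code_def)

lemma bij_word_code: "bij word_code"
proof (rule bijI)
  show "inj word_code"
  proof (rule injI)
    fix v w assume "word_code v = word_code w"
    then show "v = w"
    proof (induction v arbitrary: w rule: rev_induct)
      case Nil
      then show ?case by (cases w rule: rev_cases) (auto split: if_splits)
    next
      case (snoc b v)
      then obtain b' w' where w: "w = w' @ [b']" by (cases w rule: rev_cases) (auto split: if_splits)
      have eq: "2 * word_code v + (if b then 2 else 1) = 2 * word_code w' + (if b' then 2 else 1)"
        using snoc.prems w by simp
      then have "b = b'" by (cases b; cases b'; simp; presburger)
      with eq have "word_code v = word_code w'" by simp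
      with snoc.IH \<open>b = b'\<close> w show ?case by simp
    qed
  qed
  show "surj word_code"
  proof -
    have "\<exists>w. word_code w = n" for n
    proof (induction n rule: less_induct)
      case (less n)
      show ?case
      proof (cases "n = 0")
        case True
        then show ?thesis using word_code_Nil by blast
      next
        case False
        then obtain w where "word_code w = (n - 1) div 2" using less by force
        then have "word_code (w @ [even n]) = n" using False by (cases "even n"; simp; presburger)
        then show ?thesis by blast
      qed
    qed
    then show ?thesis by (metis surjI)
  qed
qed

definition pair :: "word \<Rightarrow> word \<Rightarrow> word" where
  "pair x y = word_decode (prod_encode (word_code x, word_code y))"

lemma bij_pair: "bij (\<lambda>(x, y). pair x y)"
proof -
  have "bij (\<lambda>(x, y). (word_code x, word_code y))"
    using bij_word_code by (auto simp: bij_def inj_def surj_def)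
  moreover have "bij prod_encode" by (rule bij_prod_encode)
  moreover have "bij word_decode"
    unfolding word_decode_def using bij_word_code by (rule bij_imp_bij_inv)
  ultimately have "bij (word_decode \<circ> (prod_encode \<circ> (\<lambda>(x, y). (word_code x, word_code y))))"
    by (intro bij_comp)
  moreover have "word_decode \<circ> (prod_encode \<circ> (\<lambda>(x, y). (word_code x, word_code y)))
      = (\<lambda>(x, y). pair x y)"
    by (auto simp: pair_def)
  ultimately show ?thesis by simp
qed

lemma pair_recursive:
  "\<exists>c. \<forall>x y. computes c [word_code x, word_code y] (word_code (pair x y))"
proof -
  define add where "add = Prim (Proj 0) (Comp Succ [Proj 1])"
  define tri where "tri = Prim Zero (Comp add [Comp Succ [Proj 0], Proj 1])"
  define c where "c = Comp add [Comp tri [add], Proj 0]"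
  have proj: "i < length xs \<Longrightarrow> xs ! i = y \<Longrightarrow> computes (Proj i) xs y" for i xs y
    using computes.proj by blast
  have add: "computes add [m, n] (m + n)" for m n
  proof (induction m)
    case 0
    show ?case unfolding add_def by (auto intro!: computes.prim_0 proj)
  next
    case (Suc m)
    have "computes (Comp Succ [Proj 1]) [m, m + n, n] (Suc (m + n))"
      by (rule computes.comp[where ys = "[m + n]"]) (auto intro!: proj computes.succ)
    with Suc show ?case unfolding add_def by (auto intro: computes.prim_Suc)
  qed
  have tri: "computes tri [n] (triangle n)" for n
  proof (induction n)
    case 0
    show ?case unfolding tri_def by (auto intro!: computes.prim_0 computes.zero)
  next
    case (Suc n)
    have "computes (Comp Succ [Proj 0]) [n, triangle n] (Suc n)"
      by (rule computes.comp[where ys = "[n]"]) (auto intro!: proj computes.succ)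
    moreover have "computes (Proj 1) [n, triangle n] (triangle n)"
      by (auto intro!: proj)
    moreover have "computes add [Suc n, triangle n] (triangle (Suc n))"
      using add[of "Suc n" "triangle n"] by (simp add: add.commute)
    ultimately have "computes (Comp add [Comp Succ [Proj 0], Proj 1]) [n, triangle n]
        (triangle (Suc n))"
      by (intro computes.comp[where ys = "[Suc n, triangle n]"]) auto
    with Suc show ?case unfolding tri_def by (auto intro: computes.prim_Suc)
  qed
  have "computes c [m, n] (prod_encode (m, n))" for m n
  proof -
    have "computes (Comp tri [add]) [m, n] (triangle (m + n))"
      by (rule computes.comp[where ys = "[m + n]"]) (auto intro!: add tri)
    moreover have "computes (Proj 0) [m, n] m" by (auto intro!: proj)
    ultimately show ?thesis unfolding c_def prod_encode_def
      by (auto intro!: computes.comp[where ys = "[triangle (m + n), m]"] add)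
  qed
  moreover have "word_code (word_decode n) = n" for n
    unfolding word_decode_def using bij_word_code by (simp add: bij_def surj_f_inv_f)
  ultimately show ?thesis by (auto simp: pair_def)
qed

definition F_REC :: "(word \<Rightarrow> word) set" where
  "F_REC = {f. \<exists>c. \<forall>w. computes c [word_code w] (word_code (f w))}"

definition recursively_enumerable :: "word set \<Rightarrow> bool" where
  "recursively_enumerable S \<longleftrightarrow> (\<exists>c. \<forall>w. w \<in> S \<longleftrightarrow> (\<exists>y. computes c [word_code w] y))"

definition cylinder :: "word set \<Rightarrow> bool" where
  "cylinder A \<longleftrightarrow> (\<exists>B. \<exists>h \<in> F_REC. bij h \<and> h ` A = {pair b y | b y. b \<in> B})"

text \<open>
  Only total functions are considered below, so being defined on all of \<open>A\<close> is automatic.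
\<close>

definition compression_function :: "(word \<Rightarrow> word) \<Rightarrow> word set \<Rightarrow> bool" where
  "compression_function f A \<longleftrightarrow> f ` A = UNIV \<and> inj_on f A"

definition compressible :: "(word \<Rightarrow> word) set \<Rightarrow> word set \<Rightarrow> bool" where
  "compressible F A \<longleftrightarrow> (\<exists>f \<in> F. compression_function f A)"

end

theory Submission imports Defs begin

text \<open>
  Let \<open>h\<close> be the isomorphism of the cylinder \<open>A\<close> with \<open>B \<times> \<Sigma>\<^sup>*\<close> and fix \<open>b \<in> B\<close>. The row
  \<open>{b} \<times> \<Sigma>\<^sup>*\<close> gives elements \<open>r z s \<in> A\<close> indexed by words \<open>z\<close> and stages \<open>s\<close>, and the
  compression function is the identity on the rest of \<open>A\<close>. On column \<open>z\<close> of the row it is the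
  identity if \<open>z \<in> A\<close>. If \<open>z\<close> is enumerated into the complement of \<open>A\<close> at stage \<open>t\<close>, then room for
  \<open>z\<close> is made as in Hilbert's hotel: \<open>r z s\<close> is fixed for \<open>s \<le> t\<close>, \<open>r z (t + 1)\<close> is sent to \<open>z\<close>,
  and \<open>r z s\<close> is sent to \<open>r z (s - 1)\<close> for \<open>s > t + 1\<close>. At \<open>r z s\<close> one only has to know what
  happened before stage \<open>s\<close>, so the map is recursive.
\<close>

section \<open>Total recursive functions\<close>

text \<open>Total recursive functions are given as functions on argument lists. The closure lemmas
  then build them as lambda terms, and no program has to be written out.\<close>

definition recfun :: "nat \<Rightarrow> (nat list \<Rightarrow> nat) \<Rightarrow> bool" where
  "recfun k F \<longleftrightarrow> (\<exists>c. \<forall>xs. length xs = k \<longrightarrow> computes c xs (F xs))"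

lemma recfun_cong:
  assumes "recfun k F" and "\<And>xs. length xs = k \<Longrightarrow> F xs = G xs"
  shows "recfun k G"
  using assms unfolding recfun_def by metis

lemma recfun_nth: "i < k \<Longrightarrow> recfun k (\<lambda>xs. xs ! i)"
  unfolding recfun_def using computes.proj by blast

lemma recfun_comp:
  assumes "recfun (length Fs) G" and "\<And>F. F \<in> set Fs \<Longrightarrow> recfun k F"
  shows "recfun k (\<lambda>xs. G (map (\<lambda>F. F xs) Fs))"
proof -
  obtain c where c: "\<And>ys. length ys = length Fs \<Longrightarrow> computes c ys (G ys)"
    using assms(1) unfolding recfun_def by blast
  have "\<forall>F\<in>set Fs. \<exists>d. \<forall>xs. length xs = k \<longrightarrow> computes d xs (F xs)"
    using assms(2) unfolding recfun_def by blast
  then obtain e where e: "\<And>F xs. F \<in> set Fs \<Longrightarrow> length xs = k \<Longrightarrow> computes (e F) xs (F xs)"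
    by (auto dest!: bchoice)
  have "computes (Comp c (map e Fs)) xs (G (map (\<lambda>F. F xs) Fs))" if "length xs = k" for xs
    by (rule computes.comp[where ys = "map (\<lambda>F. F xs) Fs"])
      (auto simp: list_all2_conv_all_nth that intro!: e c)
  then show ?thesis unfolding recfun_def by blast
qed

lemma recfun_comp1:
  assumes "recfun 1 (\<lambda>ys. G (ys ! 0))" and "recfun k F"
  shows "recfun k (\<lambda>xs. G (F xs))"
  using recfun_comp[of "[F]" "\<lambda>ys. G (ys ! 0)" k] assms by simp

lemma recfun_comp2:
  assumes "recfun 2 (\<lambda>ys. G (ys ! 0) (ys ! 1))" and "recfun k F1" and "recfun k F2"
  shows "recfun k (\<lambda>xs. G (F1 xs) (F2 xs))"
  using recfun_comp[of "[F1, F2]" "\<lambda>ys. G (ys ! 0) (ys ! 1)" k] assms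
  by (auto simp: numeral_2_eq_2)

lemma recfun_0: "recfun k (\<lambda>_. 0)"
  unfolding recfun_def using computes.zero by blast

lemma recfun_Suc:
  assumes "recfun k F"
  shows "recfun k (\<lambda>xs. Suc (F xs))"
proof (rule recfun_comp1[OF _ assms])
  show "recfun 1 (\<lambda>ys. Suc (ys ! 0))"
    unfolding recfun_def
    by (rule exI[of _ Succ]) (auto simp: length_Suc_conv intro: computes.succ)
qed

lemma recfun_const: "recfun k (\<lambda>_. n)"
  by (induction n) (auto intro: recfun_0 recfun_Suc)

text \<open>Composition with projections makes a function ignore leading arguments. The case
  \<open>j = 2\<close> turns a function of the parameters into a step function for
  \<open>Prim\<close>.\<close>

lemma recfun_drop:
  assumes "recfun k F"
  shows "recfun (j + k) (\<lambda>xs. F (drop j xs))"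
proof -
  have "recfun (j + k) (\<lambda>xs. F (map (\<lambda>G. G xs) (map (\<lambda>i xs. xs ! (j + i)) [0..<k])))"
    by (rule recfun_comp) (auto simp: assms intro!: recfun_nth)
  then show ?thesis
    by (rule recfun_cong) (auto intro!: arg_cong[of _ _ F] nth_equalityI)
qed

lemma recfun_prim:
  assumes a: "recfun k a" and b: "recfun (Suc (Suc k)) b" and n: "recfun k n"
  shows "recfun k (\<lambda>xs. rec_nat (a xs) (\<lambda>i r. b (i # r # xs)) (n xs))"
proof -
  obtain c where c: "\<And>xs. length xs = k \<Longrightarrow> computes c xs (a xs)"
    using a unfolding recfun_def by blast
  obtain d where d: "\<And>xs. length xs = Suc (Suc k) \<Longrightarrow> computes d xs (b xs)"
    using b unfolding recfun_def by blast
  have "computes (Prim c d) (m # xs) (rec_nat (a xs) (\<lambda>i r. b (i # r # xs)) m)"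
    if "length xs = k" for m xs
    using that by (induction m) (auto intro!: computes.prim_0 computes.prim_Suc c d)
  then have G: "recfun (Suc k) (\<lambda>ys. rec_nat (a (tl ys)) (\<lambda>i r. b (i # r # tl ys)) (hd ys))"
    unfolding recfun_def by (intro exI[of _ "Prim c d"]) (auto simp: length_Suc_conv)
  \<comment> \<open>\<open>Prim\<close> recurses on its first argument. Composing with
    \<open>n\<close>, followed by all projections, allows any recursive bound while the parameters
    are kept.\<close>
  have "recfun k (\<lambda>xs. (\<lambda>ys. rec_nat (a (tl ys)) (\<lambda>i r. b (i # r # tl ys)) (hd ys))
      (map (\<lambda>F. F xs) (n # map (\<lambda>i xs. xs ! i) [0..<k])))"
    by (rule recfun_comp) (auto simp: G n intro: recfun_nth)
  then show ?thesis
  proof (rule recfun_cong)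
    fix xs :: "nat list" assume "length xs = k"
    then have "map (\<lambda>F. F xs) (map (\<lambda>i xs. xs ! i) [0..<k]) = xs"
      by (auto intro!: nth_equalityI)
    then show "(\<lambda>ys. rec_nat (a (tl ys)) (\<lambda>i r. b (i # r # tl ys)) (hd ys))
      (map (\<lambda>F. F xs) (n # map (\<lambda>i xs. xs ! i) [0..<k]))
      = rec_nat (a xs) (\<lambda>i r. b (i # r # xs)) (n xs)"
      by (simp only: list.map list.sel)
  qed
qed

lemma recfun_Least:
  assumes P: "recfun (Suc k) P" and ex: "\<And>xs. length xs = k \<Longrightarrow> \<exists>n. P (n # xs) = 0"
  shows "recfun k (\<lambda>xs. LEAST n. P (n # xs) = 0)"
proof -
  obtain c where c: "\<And>xs. length xs = Suc k \<Longrightarrow> computes c xs (P xs)"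
    using P unfolding recfun_def by blast
  have "computes (Mu c) xs (LEAST n. P (n # xs) = 0)" if l: "length xs = k" for xs
  proof (rule computes.mu)
    have "P ((LEAST n. P (n # xs) = 0) # xs) = 0"
      using ex[OF l] by (rule LeastI_ex)
    then show "computes c ((LEAST n. P (n # xs) = 0) # xs) 0"
      using c l by (metis length_Cons)
    show "\<forall>m<LEAST n. P (n # xs) = 0. \<exists>y. computes c (m # xs) (Suc y)"
    proof (intro allI impI)
      fix m assume "m < (LEAST n. P (n # xs) = 0)"
      then have "P (m # xs) \<noteq> 0" by (rule not_less_Least)
      then show "\<exists>y. computes c (m # xs) (Suc y)"
        using c l by (metis length_Cons not0_implies_Suc)
    qed
  qed
  then show ?thesis unfolding recfun_def by blast
qed

section \<open>Case distinctions and arithmetic\<close>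

lemma recfun_if_0:
  assumes "recfun k n" and "recfun k a" and "recfun k b"
  shows "recfun k (\<lambda>xs. if n xs = 0 then a xs else b xs)"
proof -
  \<comment> \<open>As a step function, \<open>b\<close> ignores the counter and the previous value,
    so the recursion merely branches on whether \<open>n xs\<close> is zero.\<close>
  have "recfun (Suc (Suc k)) (\<lambda>ys. b (drop 2 ys))"
    using recfun_drop[OF assms(3), of 2] by simp
  from recfun_prim[OF assms(2) this assms(1)] show ?thesis
    by (rule recfun_cong) (auto split: nat.split simp: gr0_conv_Suc)
qed

lemma recfun_add:
  assumes "recfun k a" and "recfun k b"
  shows "recfun k (\<lambda>xs. a xs + b xs)"
proof -
  have "rec_nat y (\<lambda>_. Suc) x = x + y" for x y :: nat
    by (induction x) auto
  moreover have "recfun k (\<lambda>xs. rec_nat (b xs) (\<lambda>i r. (\<lambda>ys. Suc (ys ! 1)) (i # r # xs)) (a xs))"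
    by (rule recfun_prim) (auto intro!: recfun_Suc recfun_nth assms)
  ultimately show ?thesis by simp
qed

lemma recfun_pred:
  assumes "recfun k a"
  shows "recfun k (\<lambda>xs. a xs - 1)"
proof -
  have "rec_nat 0 (\<lambda>i _. i) x = x - 1" for x :: nat
    by (cases x) auto
  moreover have "recfun k (\<lambda>xs. rec_nat 0 (\<lambda>i r. (\<lambda>ys. ys ! 0) (i # r # xs)) (a xs))"
    by (rule recfun_prim) (auto intro!: recfun_0 recfun_nth assms)
  ultimately show ?thesis by simp
qed

lemma recfun_diff:
  assumes "recfun k a" and "recfun k b"
  shows "recfun k (\<lambda>xs. a xs - b xs)"
proof -
  have "rec_nat y (\<lambda>_ r. r - 1) x = y - x" for x y :: nat
    by (induction x) auto
  moreover have "recfun k (\<lambda>xs. rec_nat (a xs) (\<lambda>i r. (\<lambda>ys. ys ! 1 - 1) (i # r # xs)) (b xs))"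
    by (rule recfun_prim) (rule assms recfun_pred recfun_nth; simp)+
  ultimately show ?thesis by simp
qed

lemma recfun_if_eq:
  assumes "recfun k m" and "recfun k n" and "recfun k a" and "recfun k b"
  shows "recfun k (\<lambda>xs. if m xs = n xs then a xs else b xs)"
proof -
  \<comment> \<open>With truncated subtraction, the sum of both differences vanishes exactly when
    the two numbers are equal.\<close>
  have "recfun k (\<lambda>xs. if (m xs - n xs) + (n xs - m xs) = 0 then a xs else b xs)"
    by (intro recfun_if_0 recfun_add recfun_diff assms)
  then show ?thesis by (rule recfun_cong) auto
qed

lemma recfun_all_nonzero:
  assumes "\<And>F. F \<in> set Fs \<Longrightarrow> recfun k F"
  shows "recfun k (\<lambda>xs. if \<forall>F\<in>set Fs. F xs \<noteq> 0 then 1 else 0)"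
  using assms
proof (induction Fs)
  case Nil
  then show ?case by (simp add: recfun_const)
next
  case (Cons F Fs)
  have "recfun k (\<lambda>xs. if F xs = 0 then 0 else if \<forall>F\<in>set Fs. F xs \<noteq> 0 then 1 else 0)"
    by (intro recfun_if_0 recfun_0 Cons) (auto intro: Cons)
  then show ?case by (rule recfun_cong) auto
qed

lemma recfun_triangle:
  assumes "recfun k a"
  shows "recfun k (\<lambda>xs. triangle (a xs))"
proof -
  have "rec_nat 0 (\<lambda>i r. r + Suc i) x = triangle x" for x
    by (induction x) auto
  moreover have "recfun k (\<lambda>xs. rec_nat 0 (\<lambda>i r. (\<lambda>ys. ys ! 1 + Suc (ys ! 0)) (i # r # xs)) (a xs))"
    by (rule recfun_prim) (auto intro!: recfun_0 recfun_nth recfun_add recfun_Suc assms)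
  ultimately show ?thesis by simp
qed

lemma recfun_prod_encode:
  assumes "recfun k a" and "recfun k b"
  shows "recfun k (\<lambda>xs. prod_encode (a xs, b xs))"
  unfolding prod_encode_def by (simp add: recfun_add recfun_triangle assms)

section \<open>Inverses of the pairing function and of recursive bijections\<close>

lemma triangle_mono: "m \<le> n \<Longrightarrow> triangle m \<le> triangle n"
  unfolding triangle_def by (intro div_le_mono mult_le_mono) auto

text \<open>The code \<open>triangle (m + n) + m\<close> lies from \<open>triangle (m + n)\<close>
  up to, but not including, \<open>triangle (Suc (m + n))\<close>. A search for the first triangular
  number above the code therefore recovers the diagonal \<open>m + n\<close>, and with it both
  components.\<close>

lemma prod_diagonal:
  "(LEAST d. Suc (prod_encode (m, n)) - triangle (Suc d) = 0) = m + n"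
proof (rule Least_equality)
  show "Suc (prod_encode (m, n)) - triangle (Suc (m + n)) = 0"
    by (simp add: prod_encode_def)
next
  fix d assume "Suc (prod_encode (m, n)) - triangle (Suc d) = 0"
  then have "triangle (m + n) < triangle (Suc d)"
    by (simp add: prod_encode_def)
  then have "m + n < Suc d"
    using triangle_mono[of "Suc d" "m + n"] by (meson leD not_le)
  then show "m + n \<le> d" by simp
qed

lemma recfun_prod_decode:
  assumes "recfun k a"
  shows "recfun k (\<lambda>xs. fst (prod_decode (a xs)))"
    and "recfun k (\<lambda>xs. snd (prod_decode (a xs)))"
proof -
  define diag where "diag x = (LEAST d. Suc x - triangle (Suc d) = 0)" for x
  have diag_eq: "diag x = fst (prod_decode x) + snd (prod_decode x)" for x
    using prod_diagonal[of "fst (prod_decode x)" "snd (prod_decode x)"] by (simp add: diag_def)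
  have x_eq: "x = triangle (diag x) + fst (prod_decode x)" for x
    using prod_decode_inverse[of x]
    by (cases "prod_decode x") (simp add: diag_eq prod_encode_def)
  have "recfun 1 (\<lambda>xs. LEAST d. (\<lambda>ys. Suc (ys ! 1) - triangle (Suc (ys ! 0))) (d # xs) = 0)"
  proof (rule recfun_Least)
    show "recfun (Suc 1) (\<lambda>ys. Suc (ys ! 1) - triangle (Suc (ys ! 0)))"
      by (intro recfun_diff recfun_Suc recfun_triangle recfun_nth) auto
    fix xs :: "nat list"
    show "\<exists>d. (\<lambda>ys. Suc (ys ! 1) - triangle (Suc (ys ! 0))) (d # xs) = 0"
      \<comment> \<open>The search ends because \<open>triangle (Suc x)\<close> is at least
        \<open>Suc x\<close>.\<close>
      by (rule exI[of _ "xs ! 0"]) simp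
  qed
  then have "recfun 1 (\<lambda>xs. diag (xs ! 0))" by (simp add: diag_def)
  then have diag: "recfun k (\<lambda>xs. diag (a xs))" using assms by (rule recfun_comp1)
  have "recfun k (\<lambda>xs. a xs - triangle (diag (a xs)))"
    by (intro recfun_diff recfun_triangle diag assms)
  then show fst: "recfun k (\<lambda>xs. fst (prod_decode (a xs)))"
    by (rule recfun_cong) (metis x_eq diff_add_inverse)
  have "recfun k (\<lambda>xs. diag (a xs) - fst (prod_decode (a xs)))"
    by (intro recfun_diff diag fst)
  then show "recfun k (\<lambda>xs. snd (prod_decode (a xs)))"
    by (simp add: diag_eq)
qed

text \<open>Search for a preimage: surjectivity makes the search end, and injectivity makes the
  value found the right one.\<close>

lemma recfun_inv:
  assumes H: "recfun 1 (\<lambda>xs. H (xs ! 0))" and "bij H" and a: "recfun k a"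
  shows "recfun k (\<lambda>xs. inv H (a xs))"
proof (rule recfun_comp1[OF _ a])
  have inv: "H (inv H y) = y" for y
    using \<open>bij H\<close> by (simp add: bij_def surj_f_inv_f)
  have "recfun 1 (\<lambda>xs. LEAST n. (\<lambda>ys. if H (ys ! 0) = ys ! 1 then 0 else 1) (n # xs) = (0::nat))"
  proof (rule recfun_Least)
    show "recfun (Suc 1) (\<lambda>ys. if H (ys ! 0) = ys ! 1 then 0 else 1)"
      by (intro recfun_if_eq recfun_comp1[OF H] recfun_nth recfun_const) auto
    fix xs :: "nat list"
    show "\<exists>n. (\<lambda>ys. if H (ys ! 0) = ys ! 1 then 0 else 1) (n # xs) = (0::nat)"
      by (rule exI[of _ "inv H (xs ! 0)"]) (simp add: inv)
  qed
  moreover have "(LEAST n. (if H n = y then 0 else 1) = (0::nat)) = inv H y" for y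
    by (rule Least_equality) (use \<open>bij H\<close> inv in \<open>auto simp: bij_def split: if_splits\<close>)
  ultimately show "recfun 1 (\<lambda>xs. inv H (xs ! 0))"
    by simp
qed

section \<open>Stage approximations\<close>

text \<open>
  The value is \<open>0\<close> as long as stage \<open>s\<close> shows no convergence, and \<open>Suc y\<close> if it shows the
  output \<open>y\<close>. The stage only bounds the searches of \<open>Mu\<close>.
\<close>

fun approx :: "recf \<Rightarrow> nat \<Rightarrow> nat list \<Rightarrow> nat" where
  "approx Zero s xs = 1"
| "approx Succ s xs = (if length xs = 1 then Suc (Suc (xs ! 0)) else 0)"
| "approx (Proj i) s xs = (if i < length xs then Suc (xs ! i) else 0)"
| "approx (Comp f gs) s xs =
    (if \<forall>g\<in>set gs. approx g s xs \<noteq> 0 then approx f s (map (\<lambda>g. approx g s xs - 1) gs) else 0)"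
| "approx (Prim f g) s xs =
    (if xs = [] then 0
     else rec_nat (approx f s (tl xs))
       (\<lambda>i r. if r = 0 then 0 else approx g s (i # (r - 1) # tl xs)) (hd xs))"
| "approx (Mu f) s xs =
    (let n = LEAST n. n = s \<or> approx f s (n # xs) \<le> 1
     in if approx f s (n # xs) = 1 then Suc n else 0)"

text \<open>A stage only cuts searches short. It can hide an output but never produce a wrong
  one.\<close>

lemma approx_sound: "approx c s xs = Suc y \<Longrightarrow> computes c xs y"
proof (induction c arbitrary: xs y)
  case Zero
  then show ?case by (auto intro: computes.zero)
next
  case Succ
  then show ?case by (auto simp: length_Suc_conv intro: computes.succ split: if_splits)
next
  case (Proj i)
  then show ?case by (auto intro: computes.proj split: if_splits)
next
  case (Comp f gs)
  then have nz: "\<And>g. g \<in> set gs \<Longrightarrow> approx g s xs \<noteq> 0"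
    and f: "approx f s (map (\<lambda>g. approx g s xs - 1) gs) = Suc y"
    by (auto split: if_splits)
  have "computes g xs (approx g s xs - 1)" if "g \<in> set gs" for g
    by (rule Comp.IH(2)[OF that]) (use nz[OF that] in simp)
  then show ?case
    by (intro computes.comp[OF _ Comp.IH(1)[OF f]]) (simp add: list_all2_conv_all_nth)
next
  case (Prim f g)
  then obtain n zs where xs: "xs = n # zs"
    by (cases xs) auto
  have "computes (Prim f g) (n # zs) y" if "approx (Prim f g) s (n # zs) = Suc y" for y
    using that
  proof (induction n arbitrary: y)
    case 0
    then show ?case by (auto intro: computes.prim_0 Prim.IH)
  next
    case (Suc n)
    then obtain r where r: "approx (Prim f g) s (n # zs) = Suc r"
      by (cases "approx (Prim f g) s (n # zs)") (auto cong: if_cong)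
    with Suc.prems have "approx g s (n # r # zs) = Suc y" by (simp cong: if_cong)
    with Suc.IH[OF r] show ?case by (auto intro: computes.prim_Suc Prim.IH)
  qed
  with Prim.prems xs show ?case by blast
next
  case (Mu f)
  \<comment> \<open>A value \<open>\<le> 1\<close> means either no convergence (\<open>0\<close>) or
    output zero (\<open>1\<close>). Below \<open>n\<close> every value exceeds \<open>1\<close>, so
    there the computations converge to positive outputs, as \<open>Mu\<close> demands.\<close>
  define n where "n = (LEAST n. n = s \<or> approx f s (n # xs) \<le> 1)"
  have y: "y = n" "approx f s (n # xs) = 1"
    using Mu.prems by (auto simp: n_def Let_def split: if_splits)
  have "\<exists>y. computes f (m # xs) (Suc y)" if "m < n" for m
  proof -
    have "approx f s (m # xs) > 1"
      using that not_less_Least unfolding n_def by fastforce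
    then obtain y where "approx f s (m # xs) = Suc (Suc y)"
      by (metis One_nat_def less_imp_Suc_add add_Suc)
    then show ?thesis using Mu.IH by blast
  qed
  with y show ?case by (auto intro!: computes.mu Mu.IH)
qed

text \<open>A computation uses finitely many subcomputations, and these must be visible at one
  common stage. The claim for all large \<open>s\<close> lets the maximum of their bounds serve,
  without a separate proof of monotonicity in \<open>s\<close>.\<close>

lemma approx_complete:
  "computes c xs y \<Longrightarrow> \<exists>s0. \<forall>s\<ge>s0. approx c s xs = Suc y"
proof (induction rule: computes.induct)
  case (comp xs gs ys f z)
  have "\<exists>s0. \<forall>s\<ge>s0. \<forall>i<length gs. approx (gs ! i) s xs = Suc (ys ! i)"
  proof -
    have "\<forall>i\<in>{..<length gs}. \<exists>s0. \<forall>s\<ge>s0. approx (gs ! i) s xs = Suc (ys ! i)"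
      using comp.IH(1) by (auto simp: list_all2_conv_all_nth)
    then obtain S where S: "\<And>i s. i < length gs \<Longrightarrow> S i \<le> s \<Longrightarrow> approx (gs ! i) s xs = Suc (ys ! i)"
      by (auto dest!: bchoice)
    have "S i \<le> Max (S ` {..<length gs})" if "i < length gs" for i
      using that by simp
    with S show ?thesis by (meson order_trans)
  qed
  then obtain s1 where s1: "\<And>s i. s1 \<le> s \<Longrightarrow> i < length gs \<Longrightarrow> approx (gs ! i) s xs = Suc (ys ! i)"
    by blast
  obtain s2 where s2: "\<And>s. s2 \<le> s \<Longrightarrow> approx f s ys = Suc z"
    using comp.IH(2) by blast
  have len: "length gs = length ys" using comp.IH(1) by (simp add: list_all2_lengthD)
  have "approx (Comp f gs) s xs = Suc z" if "max s1 s2 \<le> s" for s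
  proof -
    have "map (\<lambda>g. approx g s xs - 1) gs = ys"
      using s1 that len by (auto intro!: nth_equalityI)
    moreover have "\<forall>g\<in>set gs. approx g s xs \<noteq> 0"
      using s1 that by (fastforce simp: in_set_conv_nth)
    ultimately show ?thesis using s2 that by simp
  qed
  then show ?case by blast
next
  case (prim_Suc f g n xs y z)
  then obtain s1 s2 where s: "\<And>s. s1 \<le> s \<Longrightarrow> approx (Prim f g) s (n # xs) = Suc y"
    "\<And>s. s2 \<le> s \<Longrightarrow> approx g s (n # y # xs) = Suc z"
    by blast
  have "approx (Prim f g) s (Suc n # xs) = Suc z" if "max s1 s2 \<le> s" for s
    using s[of s] that by (simp cong: if_cong)
  then show ?case by blast
next
  case (mu f n xs)
  then obtain s1 where s1: "\<And>s. s1 \<le> s \<Longrightarrow> approx f s (n # xs) = 1"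
    by auto
  have "\<forall>m\<in>{..<n}. \<exists>s0. \<forall>s\<ge>s0. approx f s (m # xs) > 1"
    using mu.IH(2) by fastforce
  then obtain S where S: "\<And>m s. m < n \<Longrightarrow> S m \<le> s \<Longrightarrow> approx f s (m # xs) > 1"
    by (auto dest!: bchoice)
  \<comment> \<open>Including \<open>n\<close> ensures that the search bounded by \<open>s\<close>
    reaches the least zero.\<close>
  define s0 where "s0 = Max (insert s1 (insert n (S ` {..<n})))"
  have "approx (Mu f) s xs = Suc n" if "s0 \<le> s" for s
  proof -
    have s: "s1 \<le> s" "n \<le> s" "\<And>m. m < n \<Longrightarrow> S m \<le> s"
      using that unfolding s0_def by auto
    have "(LEAST k. k = s \<or> approx f s (k # xs) \<le> 1) = n"
    proof (rule Least_equality)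
      show "n = s \<or> approx f s (n # xs) \<le> 1" using s1 s by simp
      show "n \<le> k" if "k = s \<or> approx f s (k # xs) \<le> 1" for k
        using that S s by (metis leD not_le)
    qed
    then show ?thesis using s1 s by simp
  qed
  then show ?case by blast
qed auto

text \<open>For a fixed program, the stage becomes an extra first argument, and bounded searches
  make every case total. The arity \<open>k\<close> is generalised because subprograms take
  different numbers of arguments.\<close>

lemma recfun_approx: "recfun (Suc k) (\<lambda>ys. approx c (hd ys) (tl ys))"
proof (induction c arbitrary: k)
  case Zero
  show ?case by (simp add: recfun_const)
next
  case Succ
  show ?case
  proof (cases "k = 1")
    case True
    have "recfun (Suc k) (\<lambda>ys. Suc (Suc (ys ! 1)))"
      using True by (intro recfun_Suc recfun_nth) simp
    then show ?thesis
      by (rule recfun_cong) (use True in \<open>auto simp: nth_tl\<close>)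
  next
    case False
    then show ?thesis by (intro recfun_cong[OF recfun_0]) auto
  qed
next
  case (Proj i)
  show ?case
  proof (cases "i < k")
    case True
    have "recfun (Suc k) (\<lambda>ys. Suc (ys ! Suc i))"
      using True by (intro recfun_Suc recfun_nth) simp
    then show ?thesis
      by (rule recfun_cong) (use True in \<open>auto simp: nth_tl\<close>)
  next
    case False
    then show ?thesis by (intro recfun_cong[OF recfun_0]) auto
  qed
next
  case (Comp f gs)
  let ?G = "\<lambda>g ys. approx g (hd ys) (tl ys)"
  have all: "recfun (Suc k) (\<lambda>ys. if \<forall>F\<in>set (map ?G gs). F ys \<noteq> 0 then 1 else 0)"
    by (rule recfun_all_nonzero) (auto intro: Comp.IH)
  have f: "recfun (Suc k) (\<lambda>ys. (\<lambda>ys. approx f (hd ys) (tl ys))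
      (map (\<lambda>F. F ys) ((\<lambda>ys. ys ! 0) # map (\<lambda>g ys. ?G g ys - 1) gs)))"
  proof (rule recfun_comp)
    show "recfun (length ((\<lambda>ys. ys ! 0) # map (\<lambda>g ys. ?G g ys - 1) gs))
        (\<lambda>ys. approx f (hd ys) (tl ys))"
      by (simp add: Comp.IH)
    fix F assume "F \<in> set ((\<lambda>ys. ys ! 0) # map (\<lambda>g ys. ?G g ys - 1) gs)"
    then consider "F = (\<lambda>ys. ys ! 0)" | g where "g \<in> set gs" "F = (\<lambda>ys. ?G g ys - 1)"
      by auto
    then show "recfun (Suc k) F"
    proof cases
      case 1
      then show ?thesis by (simp add: recfun_nth)
    next
      case 2
      then show ?thesis using recfun_pred[OF Comp.IH(2)] by simp
    qed
  qed
  from recfun_if_0[OF all recfun_0 f] show ?case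
    by (rule recfun_cong) (auto simp: comp_def hd_conv_nth length_Suc_conv)
next
  case (Prim f g)
  show ?case
  proof (cases k)
    case 0
    then show ?thesis by (intro recfun_cong[OF recfun_0]) (auto simp: length_Suc_conv)
  next
    case (Suc j)
    let ?tail = "\<lambda>d. map (\<lambda>i ys. ys ! (d + i)) [0..<j]"
    have tail: "map (\<lambda>F. F ys) (?tail d) = drop d ys" if "length ys = d + j" for d and ys :: "nat list"
      using that by (auto intro!: nth_equalityI)
    have "recfun (Suc k) (\<lambda>ys. (\<lambda>ys. approx f (hd ys) (tl ys))
        (map (\<lambda>F. F ys) ((\<lambda>ys. ys ! 0) # ?tail 2)))"
      by (rule recfun_comp) (use Suc Prim.IH in \<open>auto intro: recfun_nth\<close>)
    then have a: "recfun (Suc k) (\<lambda>ys. approx f (ys ! 0) (drop 2 ys))"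
      by (rule recfun_cong) (use Suc tail[of _ 2] in \<open>simp del: map_map\<close>)
    \<comment> \<open>Here \<open>ys\<close> consists of the counter, the previous value, the stage,
      the recursion argument and then the parameters. The previous value is stored as a successor,
      hence the \<open>- 1\<close>.\<close>
    have "recfun (Suc (Suc (Suc k))) (\<lambda>ys. (\<lambda>ys. approx g (hd ys) (tl ys))
        (map (\<lambda>F. F ys) ((\<lambda>ys. ys ! 2) # (\<lambda>ys. ys ! 0) # (\<lambda>ys. ys ! 1 - 1) # ?tail 4)))"
    proof (rule recfun_comp)
      show "recfun (length ((\<lambda>ys. ys ! 2) # (\<lambda>ys. ys ! 0) # (\<lambda>ys. ys ! 1 - 1) # ?tail 4))
          (\<lambda>ys. approx g (hd ys) (tl ys))"
        using Prim.IH by simp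
      have "recfun (Suc (Suc (Suc k))) (\<lambda>ys. ys ! 1 - 1)"
        by (intro recfun_pred recfun_nth) simp
      then show "recfun (Suc (Suc (Suc k))) F"
        if "F \<in> set ((\<lambda>ys. ys ! 2) # (\<lambda>ys. ys ! 0) # (\<lambda>ys. ys ! 1 - 1) # ?tail 4)" for F
        using that Suc by (auto intro: recfun_nth)
    qed
    then have "recfun (Suc (Suc (Suc k)))
        (\<lambda>ys. approx g (ys ! 2) (ys ! 0 # (ys ! 1 - 1) # drop 4 ys))"
      by (rule recfun_cong) (use Suc tail[of _ 4] in \<open>simp del: map_map\<close>)
    then have b: "recfun (Suc (Suc (Suc k)))
        (\<lambda>ys. if ys ! 1 = 0 then 0 else approx g (ys ! 2) (ys ! 0 # (ys ! 1 - 1) # drop 4 ys))"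
      by (intro recfun_if_0 recfun_nth recfun_0) auto
    have n: "recfun (Suc k) (\<lambda>ys. ys ! 1)"
      by (rule recfun_nth) (simp add: Suc)
    from recfun_prim[OF a b n] show ?thesis
      by (rule recfun_cong) (auto simp: Suc length_Suc_conv cong: if_cong)
  qed
next
  case (Mu f)
  let ?n = "\<lambda>ys. LEAST n. n = hd ys \<or> approx f (hd ys) (n # tl ys) \<le> 1"
  let ?args = "\<lambda>n. (\<lambda>ys. ys ! 0) # n # map (\<lambda>i ys. ys ! Suc i) [0..<k]"
  have f: "recfun (Suc k) (\<lambda>ys. approx f (hd ys) (n ys # tl ys))" if n: "recfun (Suc k) n" for n
  proof -
    have "recfun (Suc k) (\<lambda>ys. (\<lambda>ys. approx f (hd ys) (tl ys)) (map (\<lambda>F. F ys) (?args n)))"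
      by (rule recfun_comp) (use Mu.IH n in \<open>auto intro: recfun_nth\<close>)
    then show ?thesis
    proof (rule recfun_cong)
      fix ys :: "nat list" assume ys: "length ys = Suc k"
      then have "map (\<lambda>F. F ys) (map (\<lambda>i ys. ys ! Suc i) [0..<k]) = tl ys"
        by (auto intro!: nth_equalityI simp: nth_tl)
      then show "(\<lambda>ys. approx f (hd ys) (tl ys)) (map (\<lambda>F. F ys) (?args n))
          = approx f (hd ys) (n ys # tl ys)"
        using ys by (cases ys) (simp_all del: map_map)
    qed
  qed
  have "recfun (Suc (Suc k)) (\<lambda>ys. (\<lambda>ys. approx f (hd ys) (tl ys))
      (map (\<lambda>F. F ys) ((\<lambda>ys. ys ! 1) # (\<lambda>ys. ys ! 0) # map (\<lambda>i ys. ys ! (2 + i)) [0..<k])))"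
    by (rule recfun_comp) (use Mu.IH in \<open>auto intro: recfun_nth\<close>)
  then have f': "recfun (Suc (Suc k)) (\<lambda>ys. approx f (ys ! 1) (ys ! 0 # drop 2 ys))"
  proof (rule recfun_cong)
    fix ys :: "nat list" assume ys: "length ys = Suc (Suc k)"
    then have "map (\<lambda>F. F ys) (map (\<lambda>i ys. ys ! (2 + i)) [0..<k]) = drop 2 ys"
      by (auto intro!: nth_equalityI)
    then show "(\<lambda>ys. approx f (hd ys) (tl ys))
        (map (\<lambda>F. F ys) ((\<lambda>ys. ys ! 1) # (\<lambda>ys. ys ! 0) # map (\<lambda>i ys. ys ! (2 + i)) [0..<k]))
        = approx f (ys ! 1) (ys ! 0 # drop 2 ys)"
      by (simp del: map_map)
  qed
  \<comment> \<open>The candidate comes first and the stage second. Truncated subtraction maps both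
    \<open>0\<close> and \<open>1\<close> to zero, which is the stopping test
    \<open>\<le> 1\<close>; the stage itself always stops the search.\<close>
  let ?P = "\<lambda>ys. if ys ! 0 = ys ! 1 then 0 else approx f (ys ! 1) (ys ! 0 # drop 2 ys) - 1"
  have "recfun (Suc k) (\<lambda>ys. LEAST n. ?P (n # ys) = 0)"
  proof (rule recfun_Least)
    show "recfun (Suc (Suc k)) ?P"
      by (intro recfun_if_eq recfun_nth recfun_0 recfun_pred f') auto
    fix xs :: "nat list"
    show "\<exists>n. ?P (n # xs) = 0"
      by (rule exI[of _ "xs ! 0"]) simp
  qed
  then have n: "recfun (Suc k) ?n"
    by (rule recfun_cong) (auto simp: length_Suc_conv intro!: arg_cong[of _ _ Least])
  have "recfun (Suc k) (\<lambda>ys. if approx f (hd ys) (?n ys # tl ys) = 1 then Suc (?n ys) else 0)"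
    by (intro recfun_if_eq f n recfun_const recfun_Suc recfun_0)
  then show ?case by (simp add: Let_def cong: if_cong)
qed

section \<open>The hotel argument\<close>

text \<open>The combinatorial half of the argument: \<open>col\<close> and \<open>stage\<close>
  recover the indices, so distinct columns are disjoint and each can be rearranged separately. The
  value \<open>t z\<close> matters only for \<open>z \<notin> A\<close>.\<close>

lemma bij_betw_hotel:
  fixes r :: "'a \<Rightarrow> nat \<Rightarrow> 'a" and t :: "'a \<Rightarrow> nat"
  assumes col: "\<And>z s. col (r z s) = z"
    and stage: "\<And>z s. stage (r z s) = s"
    and r_mem: "\<And>z s. r z s \<in> A"
    and out: "\<And>x. x \<noteq> r (col x) (stage x) \<Longrightarrow> f x = x"
    and fixed: "\<And>z s. z \<in> A \<or> s \<le> t z \<Longrightarrow> f (r z s) = r z s"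
    and new: "\<And>z. z \<notin> A \<Longrightarrow> f (r z (Suc (t z))) = z"
    and shift: "\<And>z s. z \<notin> A \<Longrightarrow> t z < s \<Longrightarrow> f (r z (Suc s)) = r z s"
  shows "bij_betw f A UNIV"
proof -
  \<comment> \<open>The explicit inverse: a point outside \<open>A\<close> returns to the slot made
    for it, a shifted entry moves one stage up again, and everything else stays.\<close>
  define g where "g y = (if y \<notin> A then r y (Suc (t y))
      else if y = r (col y) (stage y) \<and> col y \<notin> A \<and> t (col y) < stage y
        then r (col y) (Suc (stage y)) else y)" for y
  have g_out: "g y = y" if "y \<in> A" "y \<noteq> r (col y) (stage y)" for y
    using that unfolding g_def by simp
  have g_new: "g z = r z (Suc (t z))" if "z \<notin> A" for z
    using that unfolding g_def by simp
  have g_fixed: "g (r z s) = r z s" if "z \<in> A \<or> s \<le> t z" for z s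
    using that unfolding g_def by (auto simp: r_mem col stage)
  have g_shift: "g (r z s) = r z (Suc s)" if "z \<notin> A" "t z < s" for z s
    using that unfolding g_def by (simp add: r_mem col stage)
  show ?thesis
  proof (rule bij_betw_byWitness[where f' = g])
    show "\<forall>x\<in>A. g (f x) = x"
    proof
      fix x assume "x \<in> A"
      show "g (f x) = x"
      proof (cases "x = r (col x) (stage x)")
        case False
        then show ?thesis using out g_out \<open>x \<in> A\<close> by simp
      next
        case True
        then obtain z s where x: "x = r z s" by blast
        have "s \<le> t z \<or> s = Suc (t z) \<or> (\<exists>s'. s = Suc s' \<and> t z < s')"
          by (cases s) auto
        then consider "z \<in> A \<or> s \<le> t z" | "z \<notin> A" "s = Suc (t z)"
          | s' where "z \<notin> A" "s = Suc s'" "t z < s'"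
          by blast
        then show ?thesis
          by cases (simp_all add: x fixed new shift g_fixed g_new g_shift)
      qed
    qed
    have cases: thesis if "y \<notin> A \<Longrightarrow> thesis"
        "y \<in> A \<Longrightarrow> y \<noteq> r (col y) (stage y) \<Longrightarrow> thesis"
        "\<And>z s. y = r z s \<Longrightarrow> z \<in> A \<or> s \<le> t z \<Longrightarrow> thesis"
        "\<And>z s. y = r z s \<Longrightarrow> z \<notin> A \<Longrightarrow> t z < s \<Longrightarrow> thesis" for y thesis
      using that not_le by blast
    show "\<forall>y\<in>UNIV. f (g y) = y"
    proof
      fix y show "f (g y) = y"
        by (rule cases[of y]) (simp_all add: out fixed new shift g_out g_fixed g_new g_shift)
    qed
    have "g y \<in> A" for y
      by (rule cases[of y]) (simp_all add: r_mem g_out g_fixed g_new g_shift)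
    then show "g ` UNIV \<subseteq> A" by blast
  qed simp
qed

text \<open>Stated on codes, so that the closure lemmas apply. The cylinder enters through one row
  contained in \<open>A\<close>, and \<open>c\<close> enumerates the complement.\<close>

lemma recursive_bij_of_coenumerable:
  assumes H: "recfun 1 (\<lambda>xs. H (xs ! 0))" and bij: "bij H"
    and row: "\<And>y. inv H (prod_encode (b, y)) \<in> A"
    and c: "\<And>n. n \<notin> A \<longleftrightarrow> (\<exists>y. computes c [n] y)"
  shows "\<exists>F. recfun 1 (\<lambda>xs. F (xs ! 0)) \<and> bij_betw F A UNIV"
proof -
  define r where "r z s = inv H (prod_encode (b, prod_encode (z, s)))" for z s
  define fstH where "fstH x = fst (prod_decode (H x))" for x
  define colH where "colH x = fst (prod_decode (snd (prod_decode (H x))))" for x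
  define stageH where "stageH x = snd (prod_decode (snd (prod_decode (H x))))" for x
  \<comment> \<open>The stage \<open>t z\<close> need not exist for \<open>z \<in> A\<close>, so it
    cannot be searched for. Capping the search at \<open>s\<close> gives the total recursive
    \<open>m\<close>, which is \<open>s\<close> as long as nothing was seen before stage
    \<open>s\<close>, and \<open>t z\<close> afterwards.\<close>
  define m where "m z s = (LEAST n. n = s \<or> approx c n [z] \<noteq> 0)" for z s
  define t where "t z = (LEAST n. approx c n [z] \<noteq> 0)" for z
  \<comment> \<open>The three branches on the row are \<open>s \<le> t z\<close> or
    \<open>z \<in> A\<close>, then \<open>s = t z + 1\<close>, then \<open>s > t z + 1\<close>. In
    the last one \<open>s\<close> is positive, so \<open>- 1\<close> is a true predecessor.\<close>
  define F where "F x = (if fstH x = b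
      then if m (colH x) (stageH x) = stageH x then x
        else if Suc (m (colH x) (stageH x)) = stageH x then colH x
        else r (colH x) (stageH x - 1)
      else x)" for x
  have H_inv: "H (inv H y) = y" for y
    using bij by (simp add: bij_def surj_f_inv_f)
  have Hr: "H (r z s) = prod_encode (b, prod_encode (z, s))" for z s
    by (simp add: r_def H_inv)
  have r_simps: "fstH (r z s) = b" "colH (r z s) = z" "stageH (r z s) = s" for z s
    by (simp_all add: fstH_def colH_def stageH_def Hr)
  have r_range: "x = r (colH x) (stageH x)" if "fstH x = b" for x
  proof -
    have "prod_encode (b, prod_encode (colH x, stageH x)) = H x"
      using that unfolding fstH_def colH_def stageH_def by auto
    then show ?thesis using bij by (simp add: r_def bij_def)
  qed
  \<comment> \<open>By soundness no element of \<open>A\<close> is ever seen as enumerated; by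
    completeness every other number eventually is.\<close>
  have in_A: "approx c n [z] = 0" if "z \<in> A" for z n
    using that c[of z] approx_sound[of c n "[z]"] by (cases "approx c n [z]") auto
  have notin_A: "approx c (t z) [z] \<noteq> 0" if z: "z \<notin> A" for z
  proof -
    obtain y where "computes c [z] y" using z c[of z] by blast
    then obtain s0 where "\<forall>s\<ge>s0. approx c s [z] = Suc y" using approx_complete by blast
    then have "approx c s0 [z] \<noteq> 0" by simp
    then show ?thesis unfolding t_def by (rule LeastI[of "\<lambda>n. approx c n [z] \<noteq> 0"])
  qed
  have m_fixed: "m z s = s" if "z \<in> A \<or> s \<le> t z" for z s
    unfolding m_def
  proof (rule Least_equality)
    fix n assume n: "n = s \<or> approx c n [z] \<noteq> 0"
    then show "s \<le> n"
      using that in_A Least_le[of "\<lambda>n. approx c n [z] \<noteq> 0" n] by (auto simp: t_def)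
  qed simp
  have m_late: "m z s = t z" if "z \<notin> A" "t z < s" for z s
    unfolding m_def
  proof (rule Least_equality)
    show "t z = s \<or> approx c (t z) [z] \<noteq> 0" using notin_A that by blast
    fix n assume "n = s \<or> approx c n [z] \<noteq> 0"
    then show "t z \<le> n"
      using that Least_le[of "\<lambda>n. approx c n [z] \<noteq> 0" n] by (auto simp: t_def)
  qed
  have "bij_betw F A UNIV"
  proof (rule bij_betw_hotel[where r = r and t = t and col = colH and stage = stageH])
    show "colH (r z s) = z" "stageH (r z s) = s" for z s
      by (rule r_simps)+
    show "r z s \<in> A" for z s unfolding r_def by (rule row)
    show "F x = x" if "x \<noteq> r (colH x) (stageH x)" for x
      using that r_range unfolding F_def by metis
    show "F (r z s) = r z s" if "z \<in> A \<or> s \<le> t z" for z s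
      using m_fixed[OF that] by (simp add: F_def r_simps)
    show "F (r z (Suc (t z))) = z" if "z \<notin> A" for z
      using m_late[OF that, of "Suc (t z)"] by (simp add: F_def r_simps)
    show "F (r z (Suc s)) = r z s" if "z \<notin> A" "t z < s" for z s
      using m_late[OF that(1), of "Suc s"] that(2) by (simp add: F_def r_simps)
  qed
  moreover have "recfun 1 (\<lambda>xs. F (xs ! 0))"
  proof -
    have x: "recfun 1 (\<lambda>xs. xs ! 0)" by (rule recfun_nth) simp
    have decode: "recfun 1 (\<lambda>xs. fstH (xs ! 0))" "recfun 1 (\<lambda>xs. colH (xs ! 0))"
      "recfun 1 (\<lambda>xs. stageH (xs ! 0))"
      unfolding fstH_def colH_def stageH_def by (intro recfun_prod_decode H)+
    have r: "recfun 1 (\<lambda>xs. r (colH (xs ! 0)) (stageH (xs ! 0) - 1))"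
      unfolding r_def
      by (intro recfun_inv[OF H bij] recfun_prod_encode recfun_const recfun_pred decode)
    \<comment> \<open>The arguments are the candidate stage, then \<open>z\<close>, then the cap
      \<open>s\<close>, which guarantees that the search ends.\<close>
    let ?P = "\<lambda>ys. if ys ! 0 = ys ! 2 then 0 else if approx c (ys ! 0) [ys ! 1] = 0 then 1 else 0"
    have "recfun 2 (\<lambda>xs. LEAST n. ?P (n # xs) = (0::nat))"
    proof (rule recfun_Least)
      have "recfun 3 (\<lambda>ys. (\<lambda>ys. approx c (hd ys) (tl ys))
          (map (\<lambda>F. F ys) [\<lambda>ys. ys ! 0, \<lambda>ys. ys ! 1]))"
        by (rule recfun_comp) (auto intro: recfun_nth recfun_approx)
      then have "recfun 3 (\<lambda>ys. approx c (ys ! 0) [ys ! 1])" by simp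
      then have "recfun 3 ?P"
        by (intro recfun_if_eq recfun_if_0 recfun_nth recfun_const) auto
      then show "recfun (Suc 2) ?P" by simp
      fix xs :: "nat list"
      show "\<exists>n. ?P (n # xs) = (0::nat)"
        by (rule exI[of _ "xs ! 1"]) simp
    qed
    then have m2: "recfun 2 (\<lambda>xs. m (xs ! 0) (xs ! 1))"
      by (rule recfun_cong) (auto simp: m_def intro!: arg_cong[of _ _ Least])
    have m: "recfun 1 (\<lambda>xs. m (colH (xs ! 0)) (stageH (xs ! 0)))"
      by (rule recfun_comp2[OF m2 decode(2,3)])
    show ?thesis
      unfolding F_def by (intro recfun_if_eq recfun_Suc recfun_const x decode r m)
  qed
  ultimately show ?thesis by blast
qed

section \<open>Transfer between words and their codes\<close>

lemma word_code_decode [simp]: "word_code (word_decode n) = n"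
  unfolding word_decode_def using bij_word_code by (simp add: bij_def surj_f_inv_f)

lemma word_decode_code [simp]: "word_decode (word_code w) = w"
  unfolding word_decode_def using bij_word_code by (simp add: bij_def)

lemma bij_word_decode: "bij word_decode"
  unfolding word_decode_def using bij_word_code by (rule bij_imp_bij_inv)

lemma F_REC_iff: "f \<in> F_REC \<longleftrightarrow> recfun 1 (\<lambda>xs. word_code (f (word_decode (xs ! 0))))"
proof
  assume "f \<in> F_REC"
  then obtain c where c: "\<And>w. computes c [word_code w] (word_code (f w))"
    unfolding F_REC_def by blast
  have "computes c [n] (word_code (f (word_decode n)))" for n
    using c[of "word_decode n"] by simp
  then show "recfun 1 (\<lambda>xs. word_code (f (word_decode (xs ! 0))))"
    unfolding recfun_def by (intro exI[of _ c]) (auto simp: length_Suc_conv)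
next
  assume "recfun 1 (\<lambda>xs. word_code (f (word_decode (xs ! 0))))"
  then obtain c where "\<And>xs. length xs = 1 \<Longrightarrow> computes c xs (word_code (f (word_decode (xs ! 0))))"
    unfolding recfun_def by blast
  then have "computes c [word_code w] (word_code (f w))" for w
    by (metis One_nat_def length_Cons list.size(3) nth_Cons_0 word_decode_code)
  then show "f \<in> F_REC" unfolding F_REC_def by blast
qed

theorem theorem21:
  fixes A :: "word set"
  assumes "cylinder A"
    and "recursively_enumerable (- A)"
    and "A \<noteq> {}"
  shows "compressible F_REC A"
proof -
  obtain B h where h: "h \<in> F_REC" "bij h" and hA: "h ` A = {pair b y | b y. b \<in> B}"
    using assms(1) unfolding cylinder_def by blast
  \<comment> \<open>An element of \<open>A\<close> is mapped by \<open>h\<close> to a pair whose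
    first component lies in \<open>B\<close>.\<close>
  obtain b where "b \<in> B" using assms(3) hA by fastforce
  obtain c where c: "\<And>w. w \<notin> A \<longleftrightarrow> (\<exists>y. computes c [word_code w] y)"
    using assms(2) unfolding recursively_enumerable_def by auto
  define H where "H n = word_code (h (word_decode n))" for n
  have H: "recfun 1 (\<lambda>xs. H (xs ! 0))"
    using h(1) by (simp add: F_REC_iff H_def)
  have bijH: "bij H"
    using bij_comp[OF bij_word_decode bij_comp[OF h(2) bij_word_code]]
    by (simp add: H_def[abs_def] comp_def)
  let ?A = "word_code ` A"
  have mem: "n \<in> ?A \<longleftrightarrow> word_decode n \<in> A" for n
    by (metis imageE imageI word_code_decode word_decode_code)
  \<comment> \<open>On codes, \<open>pair\<close> is \<open>prod_encode\<close>, so the row of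
    \<open>b\<close> in the product pulls back under \<open>H\<close> to codes of elements of
    \<open>A\<close>.\<close>
  have row: "inv H (prod_encode (word_code b, y)) \<in> ?A" for y
  proof -
    have "pair b (word_decode y) \<in> h ` A" using hA \<open>b \<in> B\<close> by blast
    then obtain w where w: "w \<in> A" "h w = pair b (word_decode y)" by auto
    then have "H (word_code w) = prod_encode (word_code b, y)"
      by (simp add: H_def pair_def)
    then have "inv H (prod_encode (word_code b, y)) = word_code w"
      using bijH by (metis bij_inv_eq_iff)
    with w(1) show ?thesis by simp
  qed
  have c': "n \<notin> ?A \<longleftrightarrow> (\<exists>y. computes c [n] y)" for n
    using c[of "word_decode n"] mem by simp
  obtain F where F: "recfun 1 (\<lambda>xs. F (xs ! 0))" "bij_betw F ?A UNIV"
    using recursive_bij_of_coenumerable[OF H bijH row c'] by blast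
  define f where "f w = word_decode (F (word_code w))" for w
  have "f \<in> F_REC" using F(1) by (simp add: F_REC_iff f_def)
  moreover have "bij_betw f A UNIV"
  proof -
    have "bij_betw word_code A ?A"
      using bij_word_code by (simp add: bij_betw_def bij_def inj_on_def)
    then have "bij_betw (word_decode \<circ> (F \<circ> word_code)) A UNIV"
      using F(2) bij_word_decode by (blast intro: bij_betw_trans)
    then show ?thesis by (simp add: f_def[abs_def] comp_def)
  qed
  ultimately show ?thesis
    unfolding compressible_def compression_function_def bij_betw_def by blast
qed

end
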